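(* The set $\mathbb{C}$ of complex numbers with the tropical addition $\smile$ and the usual multiplication is a hyperfield.
   Context: Tropical addition on $\mathbb{C}$ is the multivalued operation $\smile$ defined by: if $|a|>|b|$, then $a\smile b=\{a\}$; if $|a|<|b|$, then $a\smile b=\{b\}$; if $|a|=|b|$ and $a+b\ne0$, then $a\smile b$ is the set of all complex numbers on the (closed) shortest arc connecting $a$ with $b$ on the circle $\{z\mid|z|=|a|\}$, i.e. if $a=re^{\alpha i}$, $b=re^{\beta i}$ with $|\beta-\alpha|<\pi$, then $a\smile b=\{re^{\varphi i}\mid|\alpha-\varphi|+|\varphi-\beta|=|\alpha-\beta|\}$; if $a+b=0$, then $a\smile b$ is the closed disk $\{c\in\mathbb{C}\mid|c|\le|a|\}$. A multivalued binary operation on a set $X$ assigns to each $(a,b)\in X\times X$ a non-empty subset $a\top b\subset X$; it is extended to subsets by $A\top B=\bigcup_{a\in A,b\in B}a\top b$, and one-element sets are identified with their elements. A commutative multigroup is a set $X$ with a multivalued binary operation $\top$ such that: (1) $\top$ is associative, $(a\top b)\top c=a\top(b\top c)$, and commutative, $a\top b=b\top a$; (2) there is $0\in X$ with $0\top a=a$ for all $a$; (3) for each $a\in X$ there is a unique element $-a\in X$ with $0\in a\top(-a)$; (4) $c\in a\top b$ iff $-c\in(-a)\top(-b)$. A multiring is a set $X$ with a multivalued operation $\top$ and a (univalued) multiplication such that $(X,\top)$ is a commutative multigroup, $(X,\cdot)$ is a monoid with unity $1$, $0\cdot a=0$ for all $a$, and $a(b\top c)\subset ab\top ac$, $(b\top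 c)a\subset ba\top ca$ for all $a,b,c$. A hyperfield is a multiring $X$ such that $X\setminus\{0\}$ is a commutative group under multiplication. *)

theory Defs
  imports Complex_Main "HOL-Algebra.Group"
begin

definition mv_extend :: "('a \<Rightarrow> 'a \<Rightarrow> 'a set) \<Rightarrow> 'a set \<Rightarrow> 'a set \<Rightarrow> 'a set" where
  "mv_extend f A B = (\<Union>a\<in>A. \<Union>b\<in>B. f a b)"

text \<open>Meaningful only when the described element exists and is unique, which is
  an axiom of commutative multigroups.\<close>

definition mv_neg :: "'a set \<Rightarrow> ('a \<Rightarrow> 'a \<Rightarrow> 'a set) \<Rightarrow> 'a \<Rightarrow> 'a \<Rightarrow> 'a" where
  "mv_neg X add z a = (THE b. b \<in> X \<and> z \<in> add a b)"

locale multivalued_operation =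
  fixes X :: "'a set" and add :: "'a \<Rightarrow> 'a \<Rightarrow> 'a set"
  assumes add_nonempty: "\<lbrakk>a \<in> X; b \<in> X\<rbrakk> \<Longrightarrow> add a b \<noteq> {}"
    and add_closed: "\<lbrakk>a \<in> X; b \<in> X\<rbrakk> \<Longrightarrow> add a b \<subseteq> X"

text \<open>The neutral element is a parameter; it is determined by \<open>add\<close>,
  since two neutral elements \<open>z\<close>, \<open>z'\<close> satisfy \<open>{z'} = add z z' = add z' z = {z}\<close>.\<close>

locale commutative_multigroup = multivalued_operation X add
  for X :: "'a set" and add :: "'a \<Rightarrow> 'a \<Rightarrow> 'a set" +
  fixes z :: 'a
  assumes add_assoc:
      "\<lbrakk>a \<in> X; b \<in> X; c \<in> X\<rbrakk> \<Longrightarrow> mv_extend add (add a b) {c} = mv_extend add {a} (add b c)"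
    and add_commute: "\<lbrakk>a \<in> X; b \<in> X\<rbrakk> \<Longrightarrow> add a b = add b a"
    and zero_closed: "z \<in> X"
    and add_zero_left: "a \<in> X \<Longrightarrow> add z a = {a}"
    and neg_exists_unique: "a \<in> X \<Longrightarrow> \<exists>!b. b \<in> X \<and> z \<in> add a b"
    and add_neg_iff:
      "\<lbrakk>a \<in> X; b \<in> X; c \<in> X\<rbrakk> \<Longrightarrow>
        c \<in> add a b \<longleftrightarrow> mv_neg X add z c \<in> add (mv_neg X add z a) (mv_neg X add z b)"

locale multiring = commutative_multigroup X add z
  for X :: "'a set" and add :: "'a \<Rightarrow> 'a \<Rightarrow> 'a set" and z :: 'a +
  fixes m :: "'a \<Rightarrow> 'a \<Rightarrow> 'a" and e :: 'a
  assumes mult_monoid: "Group.monoid \<lparr>carrier = X, monoid.mult = m, one = e\<rparr>"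
    and mult_zero_left: "a \<in> X \<Longrightarrow> m z a = z"
    and distrib_left:
      "\<lbrakk>a \<in> X; b \<in> X; c \<in> X\<rbrakk> \<Longrightarrow> (\<lambda>x. m a x) ` add b c \<subseteq> add (m a b) (m a c)"
    and distrib_right:
      "\<lbrakk>a \<in> X; b \<in> X; c \<in> X\<rbrakk> \<Longrightarrow> (\<lambda>x. m x a) ` add b c \<subseteq> add (m b a) (m c a)"

locale hyperfield = multiring X add z m e
  for X :: "'a set" and add :: "'a \<Rightarrow> 'a \<Rightarrow> 'a set" and z :: 'a
    and m :: "'a \<Rightarrow> 'a \<Rightarrow> 'a" and e :: 'a +
  assumes nonzero_comm_group:
    "Group.comm_group \<lparr>carrier = X - {z}, monoid.mult = m, one = e\<rparr>"

text \<open>For \<open>|a| = |b|\<close> and \<open>a + b \<noteq> 0\<close> the angles \<open>\<alpha>\<close>, \<open>\<beta>\<close> below exist and are unique up to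
  a common shift by a multiple of \<open>2\<pi>\<close>, so the set does not depend on their choice.\<close>

definition shortest_arc :: "complex \<Rightarrow> complex \<Rightarrow> complex set" where
  "shortest_arc a b =
    {rcis (cmod a) \<phi> |\<phi>. \<exists>\<alpha> \<beta>. a = rcis (cmod a) \<alpha> \<and> b = rcis (cmod a) \<beta> \<and> \<bar>\<beta> - \<alpha>\<bar> < pi \<and>
      \<bar>\<alpha> - \<phi>\<bar> + \<bar>\<phi> - \<beta>\<bar> = \<bar>\<alpha> - \<beta>\<bar>}"

definition tropical_add :: "complex \<Rightarrow> complex \<Rightarrow> complex set"  (infixl "\<smile>" 65) where
  "a \<smile> b =
    (if cmod a > cmod b then {a}
     else if cmod a < cmod b then {b}
     else if a + b \<noteq> 0 then shortest_arc a b
     else {c. cmod c \<le> cmod a})"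

end

theory Submission
  imports Defs
begin

text \<open>
  The point: \<open>c \<in> a \<smile> b\<close> holds iff \<open>0\<close> lies in the convex hull of those of
  \<open>a\<close>, \<open>b\<close>, \<open>-c\<close> whose absolute value is maximal. Likewise, \<open>d \<in> (a \<smile> b) \<smile> c\<close> holds iff
  \<open>0\<close> lies in the convex hull of those of \<open>a\<close>, \<open>b\<close>, \<open>c\<close>, \<open>-d\<close> whose absolute value is
  maximal. This condition is symmetric in \<open>a\<close>, \<open>b\<close>, \<open>c\<close>, which gives associativity; the other
  axioms follow from the description of \<open>a \<smile> b\<close>.
\<close>

section \<open>Vanishing nonnegative combinations of dominant points\<close>

text \<open>A coefficient \<open>p\<close> of \<open>a\<close> in a nonnegative combination that involves only points of
  maximal absolute value \<open>M\<close>; the coefficients are not normalized to have sum \<open>1\<close>.\<close>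

definition dominant_weight :: "real \<Rightarrow> real \<Rightarrow> complex \<Rightarrow> bool" where
  "dominant_weight M p a \<longleftrightarrow> 0 \<le> p \<and> cmod a \<le> M \<and> (p \<noteq> 0 \<longrightarrow> cmod a = M)"

text \<open>Positivity of the total weight rules out the trivial combination. Some weight is then
  nonzero, so \<open>M\<close> is forced to be the largest of the three absolute values.\<close>

definition null3 :: "complex \<Rightarrow> complex \<Rightarrow> complex \<Rightarrow> bool" where
  "null3 a b c \<longleftrightarrow> (\<exists>M p q s. dominant_weight M p a \<and> dominant_weight M q b \<and>
     dominant_weight M s c \<and> p + q + s > 0 \<and>
     of_real p * a + of_real q * b + of_real s * c = 0)"

definition null4 :: "complex \<Rightarrow> complex \<Rightarrow> complex \<Rightarrow> complex \<Rightarrow> bool" where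
  "null4 a b c d \<longleftrightarrow> (\<exists>M p q s t. dominant_weight M p a \<and> dominant_weight M q b \<and>
     dominant_weight M s c \<and> dominant_weight M t d \<and> p + q + s + t > 0 \<and>
     of_real p * a + of_real q * b + of_real s * c + of_real t * d = 0)"

lemma dominant_weight_minus [simp]: "dominant_weight M p (- a) = dominant_weight M p a"
  by (simp add: dominant_weight_def)

lemma null3_swap: "null3 a b c \<Longrightarrow> null3 b a c"
  unfolding null3_def by (elim exE conjE, intro exI conjI) (assumption+, simp_all add: ac_simps)

lemma null3_rotate: "null3 a b c \<Longrightarrow> null3 b c a"
  unfolding null3_def by (elim exE conjE, intro exI conjI) (assumption+, simp_all add: ac_simps)

lemma null4_rotate: "null4 a b c d \<Longrightarrow> null4 b c a d"
  unfolding null4_def by (elim exE conjE, intro exI conjI) (assumption+, simp_all add: ac_simps)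

text \<open>The weights stay and \<open>M\<close> becomes \<open>cmod k * M\<close>, which also
  covers \<open>k = 0\<close>. This yields distributivity and, for \<open>k = - 1\<close>,
  compatibility with negation.\<close>

lemma null3_mult_left:
  assumes "null3 a b c" shows "null3 (k * a) (k * b) (k * c)"
proof -
  obtain M p q s where *: "dominant_weight M p a" "dominant_weight M q b"
    "dominant_weight M s c" "p + q + s > 0" "of_real p * a + of_real q * b + of_real s * c = 0"
    using assms by (auto simp: null3_def)
  have "dominant_weight (cmod k * M) r (k * x)" if "dominant_weight M r x" for r x
    using that by (auto simp: dominant_weight_def norm_mult intro: mult_left_mono)
  moreover have "of_real p * (k * a) + of_real q * (k * b) + of_real s * (k * c) = 0"
    using arg_cong[OF *(5), of "(*) k"] by (simp add: algebra_simps)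
  ultimately show ?thesis using * unfolding null3_def by blast
qed

lemma null3_uminus: "null3 a b c \<Longrightarrow> null3 (- a) (- b) (- c)"
  using null3_mult_left[of a b c "- 1"] by simp

lemma null3I:
  assumes "dominant_weight M p a" "dominant_weight M q b" "dominant_weight M s c"
    "p + q + s > 0" "of_real p * a + of_real q * b + of_real s * c = 0"
  shows "null3 a b c"
  using assms unfolding null3_def by blast

section \<open>Shortest arcs as the part of a circle inside a cone\<close>

lemma shortest_arc_commute:
  assumes "cmod a = cmod b"
  shows "shortest_arc a b = shortest_arc b a"
proof -
  have "shortest_arc a b \<subseteq> shortest_arc b a" if eq: "cmod a = cmod b" for a b
  proof
    fix c assume "c \<in> shortest_arc a b"
    then obtain \<phi> \<alpha> \<beta> where *: "c = rcis (cmod a) \<phi>" "a = rcis (cmod a) \<alpha>"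
      "b = rcis (cmod a) \<beta>" "\<bar>\<beta> - \<alpha>\<bar> < pi" "\<bar>\<alpha> - \<phi>\<bar> + \<bar>\<phi> - \<beta>\<bar> = \<bar>\<alpha> - \<beta>\<bar>"
      unfolding shortest_arc_def by auto
    then have "\<bar>\<alpha> - \<beta>\<bar> < pi" "\<bar>\<beta> - \<phi>\<bar> + \<bar>\<phi> - \<alpha>\<bar> = \<bar>\<beta> - \<alpha>\<bar>" by linarith+
    with *(1-3) show "c \<in> shortest_arc b a" unfolding shortest_arc_def eq by blast
  qed
  then show ?thesis using assms by (metis subset_antisym)
qed

text \<open>Cramer's rule in the plane: each sine is the determinant of two unit vectors. It
  supplies the cone coefficients of a point on an arc.\<close>

lemma sin_combination:
  "of_real (sin (\<beta> - \<alpha>)) * rcis r \<phi> =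
     of_real (sin (\<beta> - \<phi>)) * rcis r \<alpha> + of_real (sin (\<phi> - \<alpha>)) * rcis r \<beta>"
  by (rule complex_eqI) (simp_all add: sin_diff algebra_simps)

lemma shortest_arc_imp_cone:
  assumes c: "c \<in> shortest_arc a b" and eq: "cmod a = cmod b"
  shows "cmod c = cmod a" "\<exists>s t. 0 \<le> s \<and> 0 \<le> t \<and> c = of_real s * a + of_real t * b"
proof -
  obtain \<phi> \<alpha> \<beta> where c: "c = rcis (cmod a) \<phi>" and a: "a = rcis (cmod a) \<alpha>"
    and b: "b = rcis (cmod a) \<beta>" and d: "\<bar>\<beta> - \<alpha>\<bar> < pi"
    and bt: "\<bar>\<alpha> - \<phi>\<bar> + \<bar>\<phi> - \<beta>\<bar> = \<bar>\<alpha> - \<beta>\<bar>"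
    using c unfolding shortest_arc_def by auto
  show "cmod c = cmod a" by (simp add: c)
  define D where "D = sin (\<beta> - \<alpha>)"
  show "\<exists>s t. 0 \<le> s \<and> 0 \<le> t \<and> c = of_real s * a + of_real t * b"
  proof (cases "\<alpha> = \<beta>")
    case True
    then have "\<phi> = \<alpha>" using bt by auto
    then have "c = of_real 1 * a + of_real 0 * b" using a c by simp
    then show ?thesis by (intro exI[of _ 1] exI[of _ 0]) simp
  next
    case False
    \<comment> \<open>Since \<phi> lies between \<alpha> and \<beta>, the differences \<beta> -
      \<phi> and \<phi> - \<alpha> have the sign of \<beta> - \<alpha> or vanish, and all are below
      \<pi> in absolute value. The same then holds for the signs of their sines.\<close>
    have "D \<noteq> 0 \<and> 0 \<le> sin (\<beta> - \<phi>) / D \<and> 0 \<le> sin (\<phi> - \<alpha>) / D"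
    proof (cases "\<alpha> < \<beta>")
      case True
      then have "0 < D" unfolding D_def using d by (intro sin_gt_zero) auto
      moreover have "0 \<le> sin (\<beta> - \<phi>)" "0 \<le> sin (\<phi> - \<alpha>)"
        using True d bt by (intro sin_ge_zero; linarith)+
      ultimately show ?thesis by simp
    next
      case F: False
      have "0 < sin (\<alpha> - \<beta>)" using d F False by (intro sin_gt_zero) auto
      then have "D < 0" unfolding D_def by (metis minus_diff_eq neg_0_less_iff_less sin_minus)
      moreover have "0 \<le> sin (\<phi> - \<beta>)" "0 \<le> sin (\<alpha> - \<phi>)"
        using F d bt by (intro sin_ge_zero; linarith)+
      then have "sin (\<beta> - \<phi>) \<le> 0" "sin (\<phi> - \<alpha>) \<le> 0"
        by (metis minus_diff_eq neg_0_le_iff_le sin_minus)+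
      ultimately show ?thesis by (simp add: divide_nonpos_neg)
    qed
    moreover have "of_real D * c = of_real (sin (\<beta> - \<phi>)) * a + of_real (sin (\<phi> - \<alpha>)) * b"
      using sin_combination[of \<beta> \<alpha> "cmod a" \<phi>] unfolding D_def using a b c by simp
    ultimately have "D \<noteq> 0" "0 \<le> sin (\<beta> - \<phi>) / D" "0 \<le> sin (\<phi> - \<alpha>) / D"
      "c = of_real (sin (\<beta> - \<phi>) / D) * a + of_real (sin (\<phi> - \<alpha>) / D) * b"
      by (auto simp: field_simps)
    then show ?thesis by blast
  qed
qed

text \<open>Dividing by \<open>a\<close> rotates the picture so that \<open>a\<close> becomes 1. The
  imaginary parts of \<open>w\<close> and of \<open>w * cis (- \<theta>)\<close> show that sin
  \<psi> is nonnegative and sin (\<psi> - \<theta>) is not positive, which confines \<psi> to the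
  interval from 0 to \<theta>.\<close>

lemma cone_imp_shortest_arc_aux:
  assumes b: "b = a * cis \<theta>" and \<theta>: "0 \<le> \<theta>" "\<theta> < pi"
    and c: "c = of_real s * a + of_real t * b" and st: "0 \<le> s" "0 \<le> t"
    and eq: "cmod c = cmod a" and a0: "a \<noteq> 0"
  shows "c \<in> shortest_arc a b"
proof -
  define w where "w = c / a"
  define \<psi> where "\<psi> = Arg w"
  have "cmod w = 1" using eq a0 by (simp add: w_def norm_divide)
  then have w: "w = cis \<psi>" unfolding \<psi>_def
    by (metis mult_1 of_real_1 rcis_cmod_Arg rcis_def)
  have \<psi>: "-pi < \<psi>" "\<psi> \<le> pi" using Arg_bounded[of w] by (auto simp: \<psi>_def)
  have w2: "w = of_real s + of_real t * cis \<theta>"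
    using a0 by (simp add: w_def c b field_simps)
  have s\<psi>: "sin \<psi> = t * sin \<theta>" using arg_cong[OF w2, of Im] w by simp
  have "cis (\<psi> - \<theta>) = of_real s * cis (- \<theta>) + of_real t"
    using w w2 by (simp add: cis_mult field_simps flip: cis_divide cis_inverse)
  then have s\<psi>\<theta>: "sin (\<psi> - \<theta>) = - (s * sin \<theta>)" by (simp add: complex_eq_iff)
  have "0 \<le> \<psi> \<and> \<psi> \<le> \<theta>"
  \<comment> \<open>For \<theta> = 0 the signs of the sines would still allow \<psi> = \<pi>. Here
    \<open>w\<close> is the nonnegative real \<open>s + t\<close> of absolute value 1, hence
    1.\<close>
  proof (cases "\<theta> = 0")
    case True
    then have "cis \<psi> = of_real (s + t)" using w w2 by simp
    moreover from this have "\<bar>s + t\<bar> = 1" by (metis norm_cis norm_of_real)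
    ultimately have "w = 1" using st w by (metis abs_of_nonneg add_nonneg_nonneg of_real_1)
    then have "\<psi> = 0" unfolding \<psi>_def by (intro cis_Arg_unique) auto
    then show ?thesis using True by simp
  next
    case False
    then have "0 < sin \<theta>" using \<theta> by (intro sin_gt_zero) auto
    then have "0 \<le> sin \<psi>" "sin (\<psi> - \<theta>) \<le> 0" using s\<psi> s\<psi>\<theta> st by simp_all
    moreover have "sin \<psi> < 0" if "\<psi> < 0"
      using sin_gt_zero[of "- \<psi>"] that \<psi> by simp
    moreover have "0 < sin (\<psi> - \<theta>)" if "\<theta> < \<psi>"
      using that \<psi> \<theta> False by (intro sin_gt_zero) auto
    ultimately show ?thesis by (metis not_le)
  qed
  moreover have "c = rcis (cmod a) (Arg a + \<psi>)"
    using w a0 rcis_cmod_Arg[of a] by (simp add: w_def rcis_def field_simps flip: cis_mult)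
  moreover have "b = rcis (cmod a) (Arg a + \<theta>)"
    using b rcis_cmod_Arg[of a] by (simp add: rcis_def field_simps flip: cis_mult)
  ultimately show ?thesis unfolding shortest_arc_def using \<theta> rcis_cmod_Arg[of a]
    by (intro CollectI exI[of _ "Arg a + \<psi>"] conjI exI[of _ "Arg a"] exI[of _ "Arg a + \<theta>"]) auto
qed

lemma cone_imp_shortest_arc:
  assumes ab: "cmod a = cmod b" "a + b \<noteq> 0"
    and c: "c = of_real s * a + of_real t * b" "0 \<le> s" "0 \<le> t" "cmod c = cmod a"
  shows "c \<in> shortest_arc a b"
proof -
  have a0: "a \<noteq> 0" "b \<noteq> 0" using ab by auto
  define \<theta> where "\<theta> = Arg (b / a)"
  have "cmod (b / a) = 1" using ab a0 by (simp add: norm_divide)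
  then have ba: "b / a = cis \<theta>" unfolding \<theta>_def
    by (metis mult_1 of_real_1 rcis_cmod_Arg rcis_def)
  then have b: "b = a * cis \<theta>" using a0 by (simp add: field_simps)
  \<comment> \<open>The hypothesis that \<open>a\<close> and \<open>b\<close> are not antipodal
    enters here. A negative angle is handled below by exchanging \<open>a\<close> and
    \<open>b\<close>.\<close>
  have "\<theta> \<noteq> pi" using b ab(2) by auto
  then have \<theta>: "-pi < \<theta>" "\<theta> < pi" using Arg_bounded[of "b / a"] by (auto simp: \<theta>_def)
  show ?thesis
  proof (cases "0 \<le> \<theta>")
    case True
    then show ?thesis using cone_imp_shortest_arc_aux[OF b True \<theta>(2) c(1-4) a0(1)] by simp
  next
    case False
    have "a = b * cis (- \<theta>)" using b by (simp add: cis_mult)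
    then have "c \<in> shortest_arc b a"
      by (rule cone_imp_shortest_arc_aux[where s = t and t = s]) (use False \<theta> c ab a0 in auto)
    then show ?thesis using shortest_arc_commute[OF ab(1)] by simp
  qed
qed

section \<open>Tropical sums as vanishing combinations\<close>

text \<open>A segment between two points of a circle around 0 contains 0 only if they are antipodal:
  comparing absolute values gives \<open>p = q\<close>, unless both points are 0.\<close>

lemma add_eq_0_if_nonneg_combination_eq_0:
  assumes "of_real p * a + of_real q * b = 0" "0 \<le> p" "0 \<le> q" "p + q > 0"
    "cmod a = cmod b"
  shows "a + b = (0 :: complex)"
proof -
  have "of_real p * a = - (of_real q * b)" using assms(1) by (simp add: eq_neg_iff_add_eq_0)
  then have "p * cmod a = q * cmod b" using assms
    by (metis abs_of_nonneg norm_minus_cancel norm_mult norm_of_real)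
  then have "cmod a = 0 \<or> p = q" using assms by auto
  then show ?thesis
  proof
    assume "cmod a = 0" then show ?thesis using assms(5) by auto
  next
    assume "p = q"
    then have "of_real p * (a + b) = 0" using assms(1) by (simp add: algebra_simps)
    then show ?thesis using \<open>p = q\<close> assms by auto
  qed
qed

lemma null3_dominated_iff:
  assumes "cmod b < cmod a" shows "null3 a b c \<longleftrightarrow> a + c = 0"
proof
  assume "null3 a b c"
  then obtain M p q s where *: "dominant_weight M p a" "dominant_weight M q b"
    "dominant_weight M s c" "p + q + s > 0" "of_real p * a + of_real q * b + of_real s * c = 0"
    by (auto simp: null3_def)
  have q: "q = 0" using * assms by (auto simp: dominant_weight_def)
  \<comment> \<open>If \<open>s = 0\<close>, then \<open>a = 0\<close>; if \<open>p = 0\<close>,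
    then \<open>c = 0\<close> and so \<open>M = 0\<close>. Both contradict that \<open>a\<close> is
    strictly longer than \<open>b\<close>.\<close>
  have "p \<noteq> 0 \<and> s \<noteq> 0"
    using * assms q by (auto simp: dominant_weight_def)
  then have "cmod a = cmod c" using * by (auto simp: dominant_weight_def)
  then show "a + c = 0" using add_eq_0_if_nonneg_combination_eq_0[of p a s c] * q
    by (auto simp: dominant_weight_def)
next
  assume "a + c = 0"
  then have "c = - a" by (simp add: add_eq_0_iff)
  then show "null3 a b c"
    by (intro null3I[of "cmod a" 1 a 0 b 1 c]) (use assms in \<open>auto simp: dominant_weight_def\<close>)
qed

text \<open>If \<open>c\<close> were strictly longer than \<open>a\<close>, then \<open>a\<close>
  would be dominated in the triple rotated to start with \<open>c\<close>, and
  \<open>null3_dominated_iff\<close> would give \<open>c = a\<close>.\<close>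

lemma null3_opposite_iff: "null3 a (- a) c \<longleftrightarrow> cmod c \<le> cmod a"
proof
  assume "null3 a (- a) c"
  then show "cmod c \<le> cmod a"
    by (metis add.right_neutral leI less_irrefl minus_add_cancel norm_minus_cancel norm_zero
        null3_dominated_iff null3_rotate order.strict_trans2 add_eq_0_iff)
next
  assume "cmod c \<le> cmod a"
  then show "null3 a (- a) c"
    by (intro null3I[of "cmod a" 1 a 1 "-a" 0 c]) (auto simp: dominant_weight_def)
qed

lemma null3_shortest_arc_iff:
  assumes "cmod a = cmod b" "a + b \<noteq> 0"
  shows "null3 a b (- c) \<longleftrightarrow> c \<in> shortest_arc a b"
proof
  assume "null3 a b (- c)"
  then obtain M p q s where *: "dominant_weight M p a" "dominant_weight M q b"
    "dominant_weight M s c" "p + q + s > 0" "of_real p * a + of_real q * b = of_real s * c"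
    by (auto simp: null3_def)
  \<comment> \<open>With \<open>s = 0\<close> the points \<open>a\<close> and \<open>b\<close> alone
    would balance and hence be antipodal.\<close>
  have "s \<noteq> 0"
    using add_eq_0_if_nonneg_combination_eq_0[of p a q b] * assms by (auto simp: dominant_weight_def)
  then have s: "s > 0" "cmod c = M" using * by (auto simp: dominant_weight_def)
  have "cmod c = cmod a"
  proof (cases "p = 0 \<and> q = 0")
    case True
    then have "c = 0" using * s by auto
    then show ?thesis using * s by (auto simp: dominant_weight_def)
  next
    case False
    then show ?thesis using * s assms by (auto simp: dominant_weight_def)
  qed
  moreover have "c = of_real (p / s) * a + of_real (q / s) * b"
    using *(5) s by (simp add: field_simps)
  ultimately show "c \<in> shortest_arc a b"
    using cone_imp_shortest_arc[OF assms, of c "p / s" "q / s"] * s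
    by (auto simp: dominant_weight_def)
next
  assume "c \<in> shortest_arc a b"
  from shortest_arc_imp_cone[OF this assms(1)] obtain s t where
    c: "cmod c = cmod a" "0 \<le> s" "0 \<le> t" "c = of_real s * a + of_real t * b" by blast
  show "null3 a b (- c)"
  proof (rule null3I[of "cmod a" s a t b 1 "- c"])
    show "of_real s * a + of_real t * b + of_real 1 * - c = 0" using c(4) by simp
  qed (use assms c(1-3) in \<open>simp_all add: dominant_weight_def\<close>)
qed

lemma tropical_add_iff_null3: "c \<in> a \<smile> b \<longleftrightarrow> null3 a b (- c)"
proof -
  consider "cmod b < cmod a" | "cmod a < cmod b" | "cmod a = cmod b" "a + b \<noteq> 0"
    | "cmod a = cmod b" "a + b = 0" by linarith
  then show ?thesis
  proof cases
    case 1
    then show ?thesis by (auto simp: tropical_add_def null3_dominated_iff)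
  next
    case 2
    then have "null3 a b (- c) \<longleftrightarrow> b + - c = 0"
      using null3_dominated_iff[of a b "- c"] null3_swap by blast
    then show ?thesis using 2 by (auto simp: tropical_add_def)
  next
    case 3
    then show ?thesis by (simp add: tropical_add_def null3_shortest_arc_iff)
  next
    case 4
    then have "b = - a" by (simp add: add_eq_0_iff)
    then show ?thesis using null3_opposite_iff[of a "- c"] by (simp add: tropical_add_def)
  qed
qed

section \<open>Solvability, size bound and negatives\<close>

text \<open>The negative of the longer point works. Besides nonemptiness of sums, this supplies
  intermediate points in \<open>null4_decompose\<close>.\<close>

lemma null3_ex: "\<exists>x. null3 a b x"
proof -
  have "cmod b < cmod a \<or> cmod a < cmod b \<or> cmod a = cmod b" by linarith
  moreover have "null3 a b (- a)" if "cmod b \<le> cmod a" for a b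
    by (rule null3I[of "cmod a" 1 _ 0 _ 1]) (use that in \<open>auto simp: dominant_weight_def\<close>)
  ultimately show ?thesis by (metis less_imp_le null3_swap order.refl)
qed

lemma null3_norm_le: "null3 a b c \<Longrightarrow> cmod c \<le> max (cmod a) (cmod b)"
  by (smt (verit) add_eq_0_iff norm_minus_cancel null3_dominated_iff null3_rotate)

lemma null3_zero_iff: "null3 a b 0 \<longleftrightarrow> b = - a"
proof
  assume n: "null3 a b 0"
  show "b = - a"
  proof (cases "a = 0")
    case True
    then show ?thesis using null3_norm_le[OF null3_rotate[OF null3_rotate[OF n]]] by simp
  next
    case False
    then show ?thesis
      using n null3_dominated_iff[of 0 a b] null3_swap null3_rotate
      by (metis add_eq_0_iff norm_zero zero_less_norm_iff)
  qed
next
  assume "b = - a" then show "null3 a b 0" by (simp add: null3_opposite_iff)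
qed

section \<open>Four-point relations and associativity\<close>

text \<open>Eliminates \<open>x\<close>: \<open>k\<close> times the first relation plus
  \<open>r\<close> times the second has the coefficients \<open>k * p\<close>, \<open>k * q\<close>,
  \<open>r * s\<close>, \<open>r * t\<close>.\<close>

lemma null3_compose:
  assumes "null3 a b (- x)" "null3 x c d"
  shows "null4 a b c d"
proof -
  obtain M p q r where x1: "dominant_weight M p a" "dominant_weight M q b"
    "dominant_weight M r x" "p + q + r > 0" "of_real p * a + of_real q * b = of_real r * x"
    using assms(1) by (auto simp: null3_def)
  obtain N k s t where x2: "dominant_weight N k x" "dominant_weight N s c"
    "dominant_weight N t d" "k + s + t > 0" "of_real k * x + of_real s * c + of_real t * d = 0"
    using assms(2) by (auto simp: null3_def)
  have intro: "null4 a b c d" if "dominant_weight L p' a" "dominant_weight L q' b"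
     "dominant_weight L s' c" "dominant_weight L t' d" "p' + q' + s' + t' > 0"
     "of_real p' * a + of_real q' * b + of_real s' * c + of_real t' * d = 0" for L p' q' s' t'
    using that unfolding null4_def by blast
  \<comment> \<open>If \<open>x\<close> has weight 0 in one relation, its absolute value bounds
    nothing there from below. The relation free of \<open>x\<close> can be taken at the larger
    level, so it extends to all four points with zero weights.\<close>
  consider "r = 0" "N \<le> M" | "k = 0" "M \<le> N" | "r \<noteq> 0" "k \<noteq> 0"
    using x1 x2 by (cases "r = 0"; cases "k = 0") (force simp: dominant_weight_def)+
  then show ?thesis
  proof cases
    case 1
    then show ?thesis
      by (intro intro[of M p q 0 0])
        (use 1 x1 x2 in \<open>auto simp: dominant_weight_def\<close>)
  next
    case 2
    then show ?thesis
      by (intro intro[of N 0 0 s t]) (use 2 x1 x2 in \<open>auto simp: dominant_weight_def\<close>)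
  next
    case 3
    then have MN: "M = cmod x" "N = cmod x" and pos: "0 < r" "0 < k"
      using x1 x2 by (auto simp: dominant_weight_def)
    show ?thesis
    proof (cases "p = 0 \<and> q = 0 \<and> s = 0 \<and> t = 0")
      case True
      \<comment> \<open>Only \<open>x\<close> carries weight, so both levels and all four points are
        0, and any positive weight will do.\<close>
      then have "x = 0" using x1(5) 3 by simp
      then show ?thesis
        by (intro intro[of 0 1 0 0 0]) (use x1 x2 MN in \<open>auto simp: dominant_weight_def\<close>)
    next
      case False
      have "of_real (k * p) * a + of_real (k * q) * b = of_real r * (of_real k * x)"
        using arg_cong[OF x1(5), of "(*) (of_real k)"] by (simp add: algebra_simps)
      moreover have "of_real r * (of_real k * x) + of_real (r * s) * c + of_real (r * t) * d = 0"
        using arg_cong[OF x2(5), of "(*) (of_real r)"] by (simp add: algebra_simps)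
      moreover have "0 \<le> p" "0 \<le> q" "0 \<le> s" "0 \<le> t"
        using x1 x2 by (auto simp: dominant_weight_def)
      moreover from this have "0 < k * p + k * q + r * s + r * t"
        using False pos by (smt (verit) mult_nonneg_nonneg mult_pos_pos)
      ultimately show ?thesis
        by (intro intro[of "cmod x" "k * p" "k * q" "r * s" "r * t"])
          (use x1 x2 MN pos in \<open>auto simp: dominant_weight_def\<close>)
    qed
  qed
qed

lemma null4_decompose:
  assumes "null4 a b c d"
  shows "\<exists>x. null3 a b (- x) \<and> null3 x c d"
proof -
  obtain M p q s t where *: "dominant_weight M p a" "dominant_weight M q b"
    "dominant_weight M s c" "dominant_weight M t d" "p + q + s + t > 0"
     "of_real p * a + of_real q * b + of_real s * c + of_real t * d = 0"
    using assms unfolding null4_def by blast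
  define y where "y = of_real p * a + of_real q * b"
  have y: "y + of_real s * c + of_real t * d = 0" using * by (simp add: y_def)
  have cd: "of_real s * c + of_real t * d = - y"
    using y by (simp add: eq_neg_iff_add_eq_0 ac_simps)
  have M: "cmod a \<le> M" "cmod b \<le> M" "cmod c \<le> M" "cmod d \<le> M"
    and nonneg: "0 \<le> p" "0 \<le> q" "0 \<le> s" "0 \<le> t"
    using * by (auto simp: dominant_weight_def)
  consider "y \<noteq> 0" | "y = 0" "p + q > 0" | "y = 0" "s + t > 0" using *(5) by linarith
  then show ?thesis
  proof cases
    case 1
    \<comment> \<open>\<open>y\<close>, rescaled to the maximal absolute value, lies on the arcs of \<open>a\<close>, \<open>b\<close> and of \<open>-c\<close>, \<open>-d\<close>.\<close>
    then have "a \<noteq> 0 \<or> b \<noteq> 0" by (auto simp: y_def)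
    then have "M > 0" using M by (metis order.strict_trans2 zero_less_norm_iff)
    define x where "x = of_real (M / cmod y) * y"
    have x: "cmod x = M" "of_real (cmod y / M) * x = y"
      using \<open>M > 0\<close> 1 by (simp_all add: x_def norm_mult norm_divide)
    have w: "dominant_weight M (cmod y / M) x" using x \<open>M > 0\<close> by (simp add: dominant_weight_def)
    have "cmod y / M > 0" using 1 \<open>M > 0\<close> by simp
    then have "null3 a b (- x)" "null3 x c d"
      using null3I[of M p a q b "cmod y / M" "- x"] null3I[of M "cmod y / M" x s c t d]
        * w x y nonneg by (simp_all add: y_def)
    then show ?thesis by blast
  next
    case 2
    \<comment> \<open>Here \<open>a\<close> and \<open>b\<close> already balance, so
      \<open>x\<close> can get weight 0 in their relation and only has to satisfy
      \<open>cmod x \<le> M\<close>. It is therefore chosen to fit \<open>c\<close> and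
      \<open>d\<close>; the third case is the mirror image.\<close>
    obtain x where x: "null3 c d x" using null3_ex by blast
    then have "cmod x \<le> M" using null3_norm_le[OF x] M by linarith
    then have "null3 a b (- x)"
      using null3I[of M p a q b 0 "- x"] * 2 by (simp add: y_def dominant_weight_def)
    then show ?thesis using null3_rotate[OF null3_rotate[OF x]] by blast
  next
    case 3
    obtain x where x: "null3 a b x" using null3_ex by blast
    then have "cmod x \<le> M" using null3_norm_le[OF x] M by linarith
    then have "null3 (- x) c d"
      using null3I[of M 0 "- x" s c t d] * 3 cd by (simp add: dominant_weight_def)
    then show ?thesis using x by (metis minus_minus)
  qed
qed

lemma null4_iff: "null4 a b c d \<longleftrightarrow> (\<exists>x. null3 a b (- x) \<and> null3 x c d)"
  using null3_compose null4_decompose by blast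

section \<open>The hyperfield axioms\<close>

lemma tropical_add_commute: "a \<smile> b = b \<smile> a"
  by (auto simp: tropical_add_iff_null3 null3_swap)

lemma tropical_add3: "mv_extend (\<smile>) (a \<smile> b) {c} = {d. null4 a b c (- d)}"
  by (auto simp: mv_extend_def tropical_add_iff_null3 null4_iff)

lemma tropical_add_assoc: "mv_extend (\<smile>) (a \<smile> b) {c} = mv_extend (\<smile>) {a} (b \<smile> c)"
proof -
  have "mv_extend (\<smile>) {a} (b \<smile> c) = mv_extend (\<smile>) (b \<smile> c) {a}"
    by (auto simp: mv_extend_def tropical_add_commute)
  also have "\<dots> = {d. null4 b c a (- d)}" by (rule tropical_add3)
  \<comment> \<open>Rotation of the first three points has order three: two applications of
    \<open>null4_rotate\<close> give one inclusion and a single one gives the other.\<close>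
  also have "\<dots> = {d. null4 a b c (- d)}" using null4_rotate by blast
  finally show ?thesis by (simp add: tropical_add3)
qed

lemma zero_in_tropical_add_iff: "0 \<in> a \<smile> b \<longleftrightarrow> b = - a"
  by (simp add: tropical_add_iff_null3 null3_zero_iff)

lemma mv_neg_tropical_add: "mv_neg UNIV (\<smile>) 0 a = - a"
  by (simp add: mv_neg_def zero_in_tropical_add_iff)

theorem mainTheorem2:
  shows "hyperfield (UNIV :: complex set) (\<smile>) 0 (*) 1"
proof (intro hyperfield.intro hyperfield_axioms.intro multiring.intro multiring_axioms.intro
    commutative_multigroup.intro commutative_multigroup_axioms.intro multivalued_operation.intro)
  fix a b c :: complex
  show "a \<smile> b \<noteq> {}"
    using null3_ex[of a b] by (metis empty_iff minus_minus tropical_add_iff_null3)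
  show "0 \<smile> a = {a}"
    by (cases "a = 0") (auto simp: tropical_add_def)
  show "\<exists>!b. b \<in> UNIV \<and> 0 \<in> a \<smile> b" by (simp add: zero_in_tropical_add_iff)
  show "c \<in> a \<smile> b \<longleftrightarrow> mv_neg UNIV (\<smile>) 0 c \<in> mv_neg UNIV (\<smile>) 0 a \<smile> mv_neg UNIV (\<smile>) 0 b"
    unfolding mv_neg_tropical_add tropical_add_iff_null3
    using null3_uminus[of a b "- c"] null3_uminus[of "- a" "- b" "- (- c)"] by auto
  show "mv_extend (\<smile>) (a \<smile> b) {c} = mv_extend (\<smile>) {a} (b \<smile> c)" by (rule tropical_add_assoc)
  show "a \<smile> b = b \<smile> a" by (rule tropical_add_commute)
  show "(*) a ` (b \<smile> c) \<subseteq> a * b \<smile> a * c"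
    using null3_mult_left[of b c _ a] by (force simp: tropical_add_iff_null3)
  then show "(\<lambda>x. x * a) ` (b \<smile> c) \<subseteq> b * a \<smile> c * a" by (simp add: mult.commute)
next
  show "Group.monoid \<lparr>carrier = UNIV :: complex set, monoid.mult = (*), one = 1\<rparr>"
    by (rule monoidI) auto
  show "Group.comm_group \<lparr>carrier = UNIV - {0 :: complex}, monoid.mult = (*), one = 1\<rparr>"
    by (rule comm_groupI) (auto intro!: bexI[of _ "inverse _"])
qed auto

end
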